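(* Let $Q\in\mathbb{R}^{n\times n}$ be symmetric, $b,p\in\mathbb{R}^n$, and $\epsilon>0$. Let $\{x^k\}_{k\ge 0}$ and $\{d^k\}_{k\ge 0}$ be generated by the proximal point algorithm (described in the context) for the penalty problem $\min_{x\in[0,1]^n} h(x,p)$ from any starting point $x^0\in[0,1]^n$, and let $u^k,v^k\in\mathbb{R}^n$ be the Lagrange multipliers of the $k$-th subproblem (as in the context). Then $d^k\to 0$, and any cluster point $(x^\star,d^\star,u^\star,v^\star)$ of the sequence $\{(x^k,d^k,u^k,v^k)\}$ is a first-order stationary point of the penalty problem, i.e. $(x^\star,u^\star,v^\star)$ satisfies $$2(Q-P^\star)x^\star+(b+p)-u^\star+v^\star=0,\quad 0\le x^\star\le e,\quad (u^\star)^Tx^\star=0,\quad (v^\star)^T(e-x^\star)=0,\quad u^\star\ge 0,\ v^\star\ge 0 .$$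
   Context: Inequalities between vectors are componentwise; $e\in\mathbb{R}^n$ is the all-ones vector. $P^\star=\mathrm{Diag}(p)$ is the diagonal matrix with diagonal $p$. The penalty objective is $h(x,p)=x^T(Q-P^\star)x+(b+p)^Tx = x^TQx+b^Tx+\sum_{i=1}^n p_i(x_i-x_i^2)$, and the penalty problem is $\min h(x,p)$ subject to $0\le x_i\le 1$, $i=1,\dots,n$. $H_p$ is the diagonal matrix whose $j$-th diagonal entry is $h_p^j=\max\bigl(\sum_{i=1}^n|Q_{ji}|-p_j,\ \epsilon\bigr)$, where $\epsilon>0$ is fixed. Proximal point algorithm (with fixed $p$, regarded as producing an infinite sequence, i.e. run without a stopping test): start from $x^0\in[0,1]^n$. For $k=0,1,2,\dots$, let $d^k$ be the minimizer of the subproblem $$\min_{d\in\mathbb{R}^n}\ h(x^k+d,p)+d^T(H_p-Q+P^\star)d\quad\text{s.t. } 0\le x^k+d\le e,$$ whose objective equals $h(x^k,p)+\nabla h(x^k,p)^Td+d^TH_pd$ with $\nabla h(x,p)=2(Q-P^\star)x+b+p$ (gradient in $x$). Set $x^{k+1}=x^k+d^k$. (Equivalently, $x^{k+1}$ is the componentwise projection onto $[0,1]^n$ of $x^k+\tilde d^k$, with $\tilde d^k_j=-\nabla h(x^k,p)_j/(2h_p^j)$.) The multipliers $u^k,v^k$ are those in the KKT conditions of the $k$-th subproblem: $2(Q-P^\star)x^k+(b+p)+2H_pd^k-u^k+v^k=0$, $u^k,v^k\ge 0$, $(u^k)^T(x^k+d^k)=0$, $(v^k)^T(e-x^k-d^k)=0$,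 $0\le x^k+d^k\le e$. *)

theory Defs
  imports "HOL-Analysis.Analysis"
begin

(* On real^'n the library order is componentwise and 1 is the all-ones vector e. *)

definition Diag :: "real^'n \<Rightarrow> real^'n^'n" where
  "Diag p = (\<chi> i j. if i = j then p $ i else 0)"

definition penalty_obj :: "real^'n^'n \<Rightarrow> real^'n \<Rightarrow> real^'n \<Rightarrow> real^'n \<Rightarrow> real" where
  "penalty_obj Q b p x = x \<bullet> ((Q - Diag p) *v x) + (b + p) \<bullet> x"

definition prox_matrix :: "real^'n^'n \<Rightarrow> real^'n \<Rightarrow> real \<Rightarrow> real^'n^'n" where
  "prox_matrix Q p \<epsilon> = Diag (\<chi> j. max ((\<Sum>i\<in>UNIV. \<bar>Q $ j $ i\<bar>) - p $ j) \<epsilon>)"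

definition subproblem_obj ::
    "real^'n^'n \<Rightarrow> real^'n \<Rightarrow> real^'n \<Rightarrow> real \<Rightarrow> real^'n \<Rightarrow> real^'n \<Rightarrow> real" where
  "subproblem_obj Q b p \<epsilon> x d =
     penalty_obj Q b p (x + d) + d \<bullet> ((prox_matrix Q p \<epsilon> - Q + Diag p) *v d)"

(* The algorithm run without a stopping test. *)
definition proximal_point_iterates ::
    "real^'n^'n \<Rightarrow> real^'n \<Rightarrow> real^'n \<Rightarrow> real \<Rightarrow> (nat \<Rightarrow> real^'n) \<Rightarrow> (nat \<Rightarrow> real^'n) \<Rightarrow> bool" where
  "proximal_point_iterates Q b p \<epsilon> x d \<longleftrightarrow>
     0 \<le> x 0 \<and> x 0 \<le> 1 \<and>
     (\<forall>k. is_arg_min (subproblem_obj Q b p \<epsilon> (x k)) (\<lambda>d'. 0 \<le> x k + d' \<and> x k + d' \<le> 1) (d k) \<and>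
          x (Suc k) = x k + d k)"

(* KKT conditions of the subproblem at x: u belongs to 0 \<le> x + d, v to x + d \<le> e. *)
definition subproblem_KKT ::
    "real^'n^'n \<Rightarrow> real^'n \<Rightarrow> real^'n \<Rightarrow> real \<Rightarrow>
     real^'n \<Rightarrow> real^'n \<Rightarrow> real^'n \<Rightarrow> real^'n \<Rightarrow> bool" where
  "subproblem_KKT Q b p \<epsilon> x d u v \<longleftrightarrow>
     2 *\<^sub>R ((Q - Diag p) *v x) + (b + p) + 2 *\<^sub>R (prox_matrix Q p \<epsilon> *v d) - u + v = 0 \<and>
     0 \<le> u \<and> 0 \<le> v \<and>
     u \<bullet> (x + d) = 0 \<and> v \<bullet> (1 - x - d) = 0 \<and>
     0 \<le> x + d \<and> x + d \<le> 1"

definition penalty_stationary ::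
    "real^'n^'n \<Rightarrow> real^'n \<Rightarrow> real^'n \<Rightarrow> real^'n \<Rightarrow> real^'n \<Rightarrow> real^'n \<Rightarrow> bool" where
  "penalty_stationary Q b p x u v \<longleftrightarrow>
     2 *\<^sub>R ((Q - Diag p) *v x) + (b + p) - u + v = 0 \<and>
     0 \<le> x \<and> x \<le> 1 \<and>
     u \<bullet> x = 0 \<and> v \<bullet> (1 - x) = 0 \<and>
     0 \<le> u \<and> 0 \<le> v"

definition cluster_point :: "(nat \<Rightarrow> 'a::metric_space) \<Rightarrow> 'a \<Rightarrow> bool" where
  "cluster_point s l \<longleftrightarrow> (\<exists>r. strict_mono r \<and> (s \<circ> r) \<longlonglongrightarrow> l)"

end

theory Submission
  imports Defs
begin

text \<open>
  Each step decreases the penalty objective \<open>h\<close> by at least \<open>\<epsilon> * (norm d)\<^sup>2\<close>.  Write \<open>g\<close> for the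
  gradient of \<open>h\<close> at \<open>x\<close> and \<open>A = Q - Diag p\<close>, so that \<open>h (x + d) - h x = g \<bullet> d + d \<bullet> A d\<close>.
  The diagonal entries of \<open>H = prox_matrix Q p \<epsilon>\<close> dominate the absolute row sums of \<open>Q\<close> minus \<open>p\<close>,
  which gives \<open>d \<bullet> A d \<le> d \<bullet> H d\<close> (\<open>quadratic_form_le_prox\<close>).  Comparing the
  subproblem objective at \<open>d\<close> and at \<open>0\<close> would then yield only a non-strict decrease, because
  \<open>H - A\<close> may be singular.  The strictness comes from the optimality conditions: pairing the stationarity
  equation of the subproblem with \<open>d\<close> and using complementarity gives \<open>g \<bullet> d \<le> - 2 (d \<bullet> H d)\<close>
  (\<open>KKT_directional_derivative\<close>).  Together
  \<open>h (x + d) - h x \<le> - (d \<bullet> H d) \<le> - \<epsilon> * (norm d)\<^sup>2\<close> (\<open>penalty_obj_decrease\<close>).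

  The iterates stay in the unit box, where \<open>h\<close> is bounded below, so the values of \<open>h\<close> converge,
  their differences tend to zero, and \<open>d \<longlonglongrightarrow> 0\<close>.  The KKT conditions of the subproblems are
  closed conditions in \<open>(x, d, u, v)\<close>; at a cluster point they hold with \<open>d = 0\<close>, which is
  stationarity for the penalty problem.
\<close>

lemma Diag_mult_vec_nth: "(Diag p *v y) $ j = p $ j * y $ j"
  by (simp add: Diag_def matrix_vector_mult_def if_distrib[of "\<lambda>z. z * _"] cong: if_cong)

lemma inner_Diag_mult: "y \<bullet> (Diag p *v y) = (\<Sum>j\<in>UNIV. p $ j * (y $ j)\<^sup>2)"
  by (simp add: inner_vec_def Diag_mult_vec_nth power2_eq_square algebra_simps)

lemma symmetric_penalty_matrix:
  assumes "transpose Q = Q"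
  shows "transpose (Q - Diag p) = Q - Diag p"
  using assms by (simp add: transpose_def Diag_def vec_eq_iff)

lemma inner_nonneg_vec:
  fixes y z :: "real^'n"
  assumes "0 \<le> y" "0 \<le> z"
  shows "0 \<le> y \<bullet> z"
  using assms by (auto simp: inner_vec_def less_eq_vec_def intro!: sum_nonneg)

text \<open>Each product of two coordinates is split by the
  arithmetic-geometric mean inequality, and symmetry turns the column sums into row sums.\<close>

lemma symmetric_quadratic_form_le_abs_row_sums:
  fixes Q :: "real^'n^'n"
  assumes "transpose Q = Q"
  shows "y \<bullet> (Q *v y) \<le> (\<Sum>j\<in>UNIV. (\<Sum>i\<in>UNIV. \<bar>Q $ j $ i\<bar>) * (y $ j)\<^sup>2)"
proof -
  have sym: "Q $ i $ j = Q $ j $ i" for i j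
    using assms by (metis transpose_def vec_lambda_beta)
  have amgm: "a * (q * c) \<le> \<bar>q\<bar> * (a\<^sup>2 / 2) + \<bar>q\<bar> * (c\<^sup>2 / 2)" for a q c :: real
  proof -
    have "a * (q * c) \<le> \<bar>q\<bar> * (\<bar>a\<bar> * \<bar>c\<bar>)"
      using abs_ge_self[of "a * (q * c)"] by (simp add: abs_mult mult.left_commute)
    also have "\<dots> \<le> \<bar>q\<bar> * (a\<^sup>2 / 2 + c\<^sup>2 / 2)"
      using sum_squares_bound[of "\<bar>a\<bar>" "\<bar>c\<bar>"] by (intro mult_left_mono) auto
    finally show ?thesis by (simp add: distrib_left)
  qed
  have "y \<bullet> (Q *v y) = (\<Sum>j\<in>UNIV. \<Sum>i\<in>UNIV. y $ j * (Q $ j $ i * y $ i))"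
    by (simp add: inner_vec_def matrix_vector_mult_def sum_distrib_left)
  also have "\<dots> \<le> (\<Sum>j\<in>UNIV. \<Sum>i\<in>UNIV.
      \<bar>Q $ j $ i\<bar> * ((y $ j)\<^sup>2 / 2) + \<bar>Q $ j $ i\<bar> * ((y $ i)\<^sup>2 / 2))"
    by (intro sum_mono amgm)
  also have "\<dots> = (\<Sum>j\<in>UNIV. \<Sum>i\<in>UNIV. \<bar>Q $ j $ i\<bar> * ((y $ j)\<^sup>2 / 2))
      + (\<Sum>j\<in>UNIV. \<Sum>i\<in>UNIV. \<bar>Q $ j $ i\<bar> * ((y $ i)\<^sup>2 / 2))"
    by (simp add: sum.distrib)
  also have "(\<Sum>j\<in>UNIV. \<Sum>i\<in>UNIV. \<bar>Q $ j $ i\<bar> * ((y $ i)\<^sup>2 / 2))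
      = (\<Sum>j\<in>UNIV. \<Sum>i\<in>UNIV. \<bar>Q $ j $ i\<bar> * ((y $ j)\<^sup>2 / 2))"
    by (subst sum.swap) (simp add: sym)
  finally show ?thesis
    by (simp add: sum_distrib_right sum_divide_distrib flip: sum.distrib)
qed

lemma quadratic_form_le_prox:
  fixes Q :: "real^'n^'n"
  assumes "transpose Q = Q"
  shows "y \<bullet> ((Q - Diag p) *v y) \<le> y \<bullet> (prox_matrix Q p \<epsilon> *v y)"
proof -
  have "y \<bullet> ((Q - Diag p) *v y) = y \<bullet> (Q *v y) - y \<bullet> (Diag p *v y)"
    by (simp add: matrix_vector_mult_diff_rdistrib inner_diff_right)
  also have "\<dots> \<le> (\<Sum>j\<in>UNIV. ((\<Sum>i\<in>UNIV. \<bar>Q $ j $ i\<bar>) - p $ j) * (y $ j)\<^sup>2)"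
    using symmetric_quadratic_form_le_abs_row_sums[OF assms, of y]
    by (simp add: inner_Diag_mult left_diff_distrib sum_subtractf)
  also have "\<dots> \<le> y \<bullet> (prox_matrix Q p \<epsilon> *v y)"
    by (auto simp: prox_matrix_def inner_Diag_mult intro!: sum_mono mult_right_mono)
  finally show ?thesis .
qed

lemma prox_quadratic_form_ge: "\<epsilon> * (norm y)\<^sup>2 \<le> y \<bullet> (prox_matrix Q p \<epsilon> *v y)"
proof -
  have "\<epsilon> * (norm y)\<^sup>2 = (\<Sum>j\<in>UNIV. \<epsilon> * (y $ j)\<^sup>2)"
    unfolding power2_norm_eq_inner
    by (simp add: inner_vec_def sum_distrib_left power2_eq_square)
  also have "\<dots> \<le> y \<bullet> (prox_matrix Q p \<epsilon> *v y)"
    by (auto simp: prox_matrix_def inner_Diag_mult intro!: sum_mono mult_right_mono)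
  finally show ?thesis .
qed

lemma penalty_obj_add:
  assumes "transpose Q = Q"
  shows "penalty_obj Q b p (x + d) = penalty_obj Q b p x
    + (2 *\<^sub>R ((Q - Diag p) *v x) + (b + p)) \<bullet> d + d \<bullet> ((Q - Diag p) *v d)"
proof -
  have "x \<bullet> ((Q - Diag p) *v d) = d \<bullet> ((Q - Diag p) *v x)"
    by (metis dot_lmul_matrix inner_commute symmetric_penalty_matrix[OF assms]
        vector_transpose_matrix)
  then show ?thesis
    by (simp add: penalty_obj_def matrix_vector_right_distrib inner_add_left inner_add_right
        inner_commute[of d "(Q - Diag p) *v x"])
qed

text \<open>Complementarity moves the multiplier terms from \<open>x + d\<close> back to \<open>x\<close>:
  \<open>u \<bullet> d = - (u \<bullet> x)\<close> and \<open>v \<bullet> d = v \<bullet> (1 - x)\<close>, whose signs are known because \<open>x\<close> is feasible.\<close>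

lemma KKT_directional_derivative:
  assumes kkt: "subproblem_KKT Q b p \<epsilon> x d u v" and x: "0 \<le> x" "x \<le> 1"
  shows "(2 *\<^sub>R ((Q - Diag p) *v x) + (b + p)) \<bullet> d \<le> - 2 * (d \<bullet> (prox_matrix Q p \<epsilon> *v d))"
proof -
  let ?g = "2 *\<^sub>R ((Q - Diag p) *v x) + (b + p)" and ?Hd = "prox_matrix Q p \<epsilon> *v d"
  have eq: "?g + 2 *\<^sub>R ?Hd - u + v = 0" and uv: "0 \<le> u" "0 \<le> v"
    and comp: "u \<bullet> (x + d) = 0" "v \<bullet> (1 - x - d) = 0"
    using kkt by (auto simp: subproblem_KKT_def)
  have "?g = u - v - 2 *\<^sub>R ?Hd"
    using eq by (simp add: algebra_simps)
  then have "?g \<bullet> d = u \<bullet> d - v \<bullet> d - 2 * (d \<bullet> ?Hd)"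
    by (simp add: inner_diff_left inner_diff_right inner_commute)
  moreover have "u \<bullet> d = - (u \<bullet> x)" "v \<bullet> d = v \<bullet> (1 - x)"
    using comp by (simp_all add: inner_add_right inner_diff_right)
  moreover have "0 \<le> u \<bullet> x" "0 \<le> v \<bullet> (1 - x)"
    using uv x by (simp_all add: inner_nonneg_vec)
  ultimately show ?thesis by linarith
qed

lemma penalty_obj_decrease:
  assumes "transpose Q = Q" "subproblem_KKT Q b p \<epsilon> x d u v" "0 \<le> x" "x \<le> 1"
  shows "\<epsilon> * (norm d)\<^sup>2 \<le> penalty_obj Q b p x - penalty_obj Q b p (x + d)"
  using penalty_obj_add[OF assms(1), of b p x d] KKT_directional_derivative[OF assms(2-4)]
    quadratic_form_le_prox[OF assms(1), of d p \<epsilon>] prox_quadratic_form_ge[of \<epsilon> d Q p]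
  by linarith

lemma penalty_obj_bounded_below_on_box:
  fixes Q :: "real^'n^'n"
  obtains m where "\<And>x. 0 \<le> x \<Longrightarrow> x \<le> 1 \<Longrightarrow> m \<le> penalty_obj Q b p x"
proof -
  have "continuous_on {0..1} (penalty_obj Q b p)"
    unfolding penalty_obj_def
    by (intro continuous_intros linear_continuous_on_compose matrix_vector_mul_linear)
  moreover have "compact {0..1 :: real^'n}" "{0..1 :: real^'n} \<noteq> {}"
    by (simp_all add: compact_interval less_eq_vec_def)
  ultimately obtain z where "\<forall>y\<in>{0..1}. penalty_obj Q b p z \<le> penalty_obj Q b p y"
    using continuous_attains_inf by blast
  then show ?thesis using that[of "penalty_obj Q b p z"] by simp
qed

text \<open>The values \<open>f k\<close> decrease and are bounded below, so they converge and their successive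
  differences, which control the squared norms, tend to zero.\<close>

lemma sufficient_decrease_tendsto_zero:
  fixes f :: "nat \<Rightarrow> real" and d :: "nat \<Rightarrow> 'a::real_normed_vector"
  assumes "\<epsilon> > 0" and dec: "\<And>k. \<epsilon> * (norm (d k))\<^sup>2 \<le> f k - f (Suc k)"
    and bound: "\<And>k. m \<le> f k"
  shows "d \<longlonglongrightarrow> 0"
proof -
  have "f (Suc k) \<le> f k" for k
    using dec[of k] \<open>\<epsilon> > 0\<close> by (smt (verit) mult_nonneg_nonneg zero_le_power2)
  then have "decseq f" by (simp add: decseq_Suc_iff)
  then obtain L where L: "f \<longlonglongrightarrow> L"
    using decseq_convergent bound by blast
  have "(\<lambda>k. (f k - f (Suc k)) / \<epsilon>) \<longlonglongrightarrow> (L - L) / \<epsilon>"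
    using \<open>\<epsilon> > 0\<close> by (intro tendsto_intros L LIMSEQ_Suc) auto
  then have lim: "(\<lambda>k. (f k - f (Suc k)) / \<epsilon>) \<longlonglongrightarrow> 0" by simp
  have "(norm (d k))\<^sup>2 \<le> (f k - f (Suc k)) / \<epsilon>" for k
    using dec[of k] \<open>\<epsilon> > 0\<close> by (simp add: field_simps)
  then have "(\<lambda>k. (norm (d k))\<^sup>2) \<longlonglongrightarrow> 0"
    by (intro tendsto_sandwich[OF _ _ tendsto_const lim]) auto
  then have "(\<lambda>k. sqrt ((norm (d k))\<^sup>2)) \<longlonglongrightarrow> sqrt 0"
    by (rule tendsto_real_sqrt)
  then show ?thesis by (simp add: tendsto_norm_zero_iff)
qed

lemma tendsto_matrix_vector_mult:
  fixes A :: "real^'n^'m"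
  assumes "(f \<longlongrightarrow> l) F"
  shows "((\<lambda>k. A *v f k) \<longlongrightarrow> A *v l) F"
  by (rule bounded_linear.tendsto[OF matrix_vector_mul_bounded_linear assms])

lemma KKT_limit:
  assumes kkt: "\<And>k. subproblem_KKT Q b p \<epsilon> (x k) (d k) (u k) (v k)"
    and lim: "x \<longlonglongrightarrow> x'" "d \<longlonglongrightarrow> d'" "u \<longlonglongrightarrow> u'" "v \<longlonglongrightarrow> v'"
  shows "subproblem_KKT Q b p \<epsilon> x' d' u' v'"
proof -
  note K = kkt[unfolded subproblem_KKT_def]
  let ?E = "\<lambda>x d u v. 2 *\<^sub>R ((Q - Diag p) *v x) + (b + p) + 2 *\<^sub>R (prox_matrix Q p \<epsilon> *v d) - u + v"
  have "(\<lambda>k. ?E (x k) (d k) (u k) (v k)) \<longlonglongrightarrow> ?E x' d' u' v'"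
    "(\<lambda>k. u k \<bullet> (x k + d k)) \<longlonglongrightarrow> u' \<bullet> (x' + d')"
    "(\<lambda>k. v k \<bullet> (1 - x k - d k)) \<longlonglongrightarrow> v' \<bullet> (1 - x' - d')"
    by (intro tendsto_intros tendsto_matrix_vector_mult lim)+
  then have "?E x' d' u' v' = 0" "u' \<bullet> (x' + d') = 0" "v' \<bullet> (1 - x' - d') = 0"
    using K by (simp_all add: LIMSEQ_const_iff)
  moreover have "0 \<le> u'" "0 \<le> v'"
    using K by (auto intro!: lim tendsto_lowerbound[OF _ _ sequentially_bot]
        simp: less_eq_vec_def intro: tendsto_vec_nth)
  moreover have xd: "(\<lambda>k. x k + d k) \<longlonglongrightarrow> x' + d'"
    by (intro tendsto_intros lim)
  have "0 \<le> x' + d'" "x' + d' \<le> 1"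
    using K LIMSEQ_le_const[OF tendsto_vec_nth[OF xd]] LIMSEQ_le_const2[OF tendsto_vec_nth[OF xd]]
    by (simp_all add: less_eq_vec_def)
  ultimately show ?thesis by (simp add: subproblem_KKT_def)
qed

lemma KKT_zero_step_iff_stationary:
  "subproblem_KKT Q b p \<epsilon> x 0 u v \<longleftrightarrow> penalty_stationary Q b p x u v"
  by (auto simp: subproblem_KKT_def penalty_stationary_def)

theorem theorem4p2:
  fixes Q :: "real^'n^'n" and b p :: "real^'n" and \<epsilon> :: real
    and x d u v :: "nat \<Rightarrow> real^'n"
  assumes "transpose Q = Q"
    and "\<epsilon> > 0"
    and "proximal_point_iterates Q b p \<epsilon> x d"
    and "\<And>k. subproblem_KKT Q b p \<epsilon> (x k) (d k) (u k) (v k)"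
  shows "d \<longlonglongrightarrow> 0 \<and>
    (\<forall>xs ds us vs. cluster_point (\<lambda>k. (x k, d k, u k, v k)) (xs, ds, us, vs) \<longrightarrow>
       penalty_stationary Q b p xs us vs)"
proof (intro conjI allI impI)
  have start: "0 \<le> x 0" "x 0 \<le> 1" and step: "\<And>k. x (Suc k) = x k + d k"
    using assms(3) by (auto simp: proximal_point_iterates_def)
  have feasible: "0 \<le> x k" "x k \<le> 1" for k
    by (cases k; use start assms(4) step in \<open>simp add: subproblem_KKT_def\<close>)+
  obtain m where m: "\<And>x. 0 \<le> x \<Longrightarrow> x \<le> 1 \<Longrightarrow> m \<le> penalty_obj Q b p x"
    using penalty_obj_bounded_below_on_box by blast
  show d0: "d \<longlonglongrightarrow> 0"
  proof (rule sufficient_decrease_tendsto_zero)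
    show "\<epsilon> * (norm (d k))\<^sup>2 \<le> penalty_obj Q b p (x k) - penalty_obj Q b p (x (Suc k))" for k
      unfolding step by (rule penalty_obj_decrease[OF assms(1,4) feasible])
    show "m \<le> penalty_obj Q b p (x k)" for k
      by (rule m[OF feasible])
  qed (rule assms(2))
  fix xs ds us vs
  assume "cluster_point (\<lambda>k. (x k, d k, u k, v k)) (xs, ds, us, vs)"
  then obtain r where r: "strict_mono r"
    and lim: "(\<lambda>k. (x (r k), d (r k), u (r k), v (r k))) \<longlonglongrightarrow> (xs, ds, us, vs)"
    by (auto simp: cluster_point_def o_def)
  have "subproblem_KKT Q b p \<epsilon> xs 0 us vs"
  proof (rule KKT_limit)
    show "subproblem_KKT Q b p \<epsilon> (x (r k)) (d (r k)) (u (r k)) (v (r k))" for k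
      by (rule assms(4))
    show "(\<lambda>k. x (r k)) \<longlonglongrightarrow> xs" "(\<lambda>k. u (r k)) \<longlonglongrightarrow> us" "(\<lambda>k. v (r k)) \<longlonglongrightarrow> vs"
      using tendsto_fst[OF lim] tendsto_fst[OF tendsto_snd[OF tendsto_snd[OF lim]]]
        tendsto_snd[OF tendsto_snd[OF tendsto_snd[OF lim]]] by simp_all
    show "(\<lambda>k. d (r k)) \<longlonglongrightarrow> 0"
      using LIMSEQ_subseq_LIMSEQ[OF d0 r] by (simp add: o_def)
  qed
  then show "penalty_stationary Q b p xs us vs"
    by (simp add: KKT_zero_step_iff_stationary)
qed

end
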